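(* Let $\mathcal{B}=\{B(k)\colon k\in\mathbb{N}_0\setminus\{1\}\}$. If $x\in\mathcal{B}$, then every positive divisor of $x$ is in $\mathcal{B}$.
   Context: Let $\overline{\psi}$ be the multiplicative arithmetic function with $\overline{\psi}(p^{\alpha})=p^{\alpha-1}(p+1)$ for odd primes $p$ and $\overline{\psi}(2^{\alpha})=2^{\alpha-1}$, for all positive integers $\alpha$ (so $\overline{\psi}(1)=1$). For $n>1$, $\lambda(n)$ is the unique nonnegative integer with $\overline{\psi}^{\lambda(n)}(n)=2$ (where $\overline{\psi}^k$ is the $k$-th iterate, $\overline{\psi}^0(n)=n$), and $\lambda(1)=0$. $\mathbb{N}_0$ is the set of nonnegative integers. For each nonnegative integer $k\neq 1$, $B(k)$ denotes the largest odd positive integer $n$ with $\lambda(n)=k$ (such a number exists). *)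

theory Defs
  imports "HOL-Number_Theory.Number_Theory"
begin

text \<open>A multiplicative function is determined by its values at prime powers, via the
  product over the prime powers exactly dividing the argument. The lemmas below confirm that
  the product formula has the prescribed values and is multiplicative. The value at
  0 is irrelevant.\<close>

definition psi_bar :: "nat \<Rightarrow> nat" where
  "psi_bar n = (\<Prod>p\<in>prime_factors n.
     if p = 2 then 2 ^ (multiplicity p n - 1) else p ^ (multiplicity p n - 1) * (p + 1))"

text \<open>Uniqueness of the exponent uses that \<open>psi_bar 2 = 1\<close> and \<open>psi_bar 1 = 1\<close>, so an orbit
  visits 2 only once.\<close>

definition lam :: "nat \<Rightarrow> nat" where
  "lam n = (if n > 1 then (THE k. (psi_bar ^^ k) n = 2) else 0)"

text \<open>Only meaningful for \<open>k \<noteq> 1\<close>: no odd number has \<open>lam\<close>-value 1.\<close>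

definition B :: "nat \<Rightarrow> nat" where
  "B k = (GREATEST n. n > 0 \<and> odd n \<and> lam n = k)"

definition B_set :: "nat set" where
  "B_set = {B k | k. k \<noteq> 1}"

lemma psi_bar_1: "psi_bar 1 = 1"
  by (simp add: psi_bar_def)

lemma psi_bar_prime_power:
  assumes "prime p" "a > 0"
  shows "psi_bar (p ^ a) = (if p = 2 then 2 ^ (a - 1) else p ^ (a - 1) * (p + 1))"
  using assms by (auto simp: psi_bar_def prime_factors_power prime_prime_factors)

lemma psi_bar_mult:
  assumes "coprime m n" "m > 0" "n > 0"
  shows "psi_bar (m * n) = psi_bar m * psi_bar n"
proof -
  define f where "f = (\<lambda>p a::nat. if p = 2 then 2 ^ (a - 1) else p ^ (a - 1) * (p + 1 :: nat))"
  have psi: "psi_bar k = (\<Prod>p\<in>prime_factors k. f p (multiplicity p k))" for k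
    by (simp add: psi_bar_def f_def)
  have disj: "prime_factors m \<inter> prime_factors n = {}"
    using assms(1) by (auto simp: in_prime_factors_iff dest: coprime_common_divisor)
  have mult: "multiplicity p (m * n) = multiplicity p m + multiplicity p n"
    if "prime p" for p
    using that assms by (simp add: prime_elem_multiplicity_mult_distrib)
  have z: "multiplicity p k = 0" if "prime p" "p \<notin> prime_factors k" "k > 0" for p k :: nat
    using that by (auto simp: in_prime_factors_iff not_dvd_imp_multiplicity_0)
  have un: "prime_factors (m * n) = prime_factors m \<union> prime_factors n"
    using assms by (simp add: prime_factors_product)
  have "psi_bar (m * n) = (\<Prod>p\<in>prime_factors m. f p (multiplicity p (m * n)))
      * (\<Prod>p\<in>prime_factors n. f p (multiplicity p (m * n)))"
    unfolding psi un by (rule prod.union_disjoint) (use disj in auto)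
  also have "(\<Prod>p\<in>prime_factors m. f p (multiplicity p (m * n))) = psi_bar m"
    unfolding psi
  proof (rule prod.cong)
    fix p assume p: "p \<in> prime_factors m"
    then have "multiplicity p n = 0" using z[of p n] disj assms by auto
    then show "f p (multiplicity p (m * n)) = f p (multiplicity p m)"
      using mult[of p] p by (simp add: in_prime_factors_imp_prime)
  qed simp
  also have "(\<Prod>p\<in>prime_factors n. f p (multiplicity p (m * n))) = psi_bar n"
    unfolding psi
  proof (rule prod.cong)
    fix p assume p: "p \<in> prime_factors n"
    then have "multiplicity p m = 0" using z[of p m] disj assms by auto
    then show "f p (multiplicity p (m * n)) = f p (multiplicity p n)"
      using mult[of p] p by (simp add: in_prime_factors_imp_prime)
  qed simp
  finally show ?thesis .
qed

end

theory Submission imports Defs begin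

text \<open>Let \<open>c\<close> be the completely additive function with \<open>c 2 = 1\<close> and \<open>c p = c (p + 1)\<close> for odd
  primes \<open>p\<close>. Then \<open>psi_bar\<close> lowers \<open>c\<close> by one on even numbers and preserves it on odd ones, and
  \<open>psi_bar n\<close> is even for \<open>n > 2\<close>; hence \<open>lam\<close> agrees with \<open>c\<close> on odd numbers and is completely
  additive there. If \<open>x = d * e\<close> is a value of \<open>B\<close>, an odd \<open>n > d\<close> with \<open>lam n = lam d\<close> would
  make \<open>n * e\<close> a larger competitor of \<open>x\<close>, so \<open>d = B (lam d)\<close>.\<close>

section \<open>The additive weight\<close>

text \<open>The factor 2 of \<open>p + 1\<close> is split off so that the recursion visits only primes below \<open>p\<close>.\<close>

function prime_weight :: "nat \<Rightarrow> nat" where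
  "prime_weight p = (if p \<le> 2 then 1
     else 1 + (\<Sum>q\<in>#prime_factorization ((p + 1) div 2). prime_weight q))"
  by auto
termination
proof (relation "measure id")
  fix p q :: nat
  assume "\<not> p \<le> 2" "q \<in># prime_factorization ((p + 1) div 2)"
  then have "q \<le> (p + 1) div 2"
    by (intro dvd_imp_le) (auto simp: in_prime_factors_iff)
  with \<open>\<not> p \<le> 2\<close> show "(q, p) \<in> measure id" by simp
qed simp

declare prime_weight.simps [simp del]

text \<open>This is the function \<open>c\<close> of the overview.\<close>

definition weight :: "nat \<Rightarrow> nat" where
  "weight n = (\<Sum>p\<in>#prime_factorization n. prime_weight p)"

lemma weight_1 [simp]: "weight (Suc 0) = 0"
  by (simp add: weight_def)

lemma weight_prime: "prime p \<Longrightarrow> weight p = prime_weight p"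
  by (simp add: weight_def prime_factorization_prime)

lemma weight_2 [simp]: "weight 2 = 1"
  by (simp add: weight_prime prime_weight.simps)

lemma weight_mult: "m > 0 \<Longrightarrow> n > 0 \<Longrightarrow> weight (m * n) = weight m + weight n"
  by (simp add: weight_def prime_factorization_mult)

lemma weight_power: "n > 0 \<Longrightarrow> weight (n ^ k) = k * weight n"
  by (induction k) (simp_all add: weight_mult)

lemma weight_prod:
  "(\<And>i. i \<in> A \<Longrightarrow> f i > 0) \<Longrightarrow> weight (\<Prod>i\<in>A. f i) = (\<Sum>i\<in>A. weight (f i))"
  by (induction A rule: infinite_finite_induct) (simp_all add: weight_mult prod_pos)

text \<open>The factor 2 split off from \<open>p + 1\<close> has weight 1, which is the summand 1 in
  the recursion for \<open>prime_weight\<close>.\<close>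

lemma weight_odd_prime:
  assumes "prime p" "p \<noteq> 2"
  shows "weight (p + 1) = weight p"
proof -
  have p: "p > 2" "odd p"
    using assms prime_ge_2_nat[of p] prime_odd_nat[of p] by auto
  have "weight (2 * ((p + 1) div 2)) = 1 + weight ((p + 1) div 2)"
    using p by (subst weight_mult) auto
  also have "\<dots> = prime_weight p"
    using p by (simp add: weight_def prime_weight.simps[of p])
  finally show ?thesis
    using p assms by (simp add: weight_prime)
qed

section \<open>Size bounds from the weight\<close>

lemma prod_mset_le_power_sum_mset:
  fixes f :: "nat \<Rightarrow> nat"
  assumes "\<And>x. x \<in># M \<Longrightarrow> x \<le> 2 ^ f x"
  shows "prod_mset M \<le> 2 ^ (\<Sum>x\<in>#M. f x)"
  using assms by (induction M) (auto simp: power_add intro!: mult_le_mono)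

text \<open>Strong induction: for odd \<open>p\<close> the primes dividing
  \<open>(p + 1) div 2\<close> lie below \<open>p\<close>, and doubling their combined bound
  accounts for the extra 1 in the recursion.\<close>

lemma prime_le_power_prime_weight: "prime p \<Longrightarrow> p \<le> 2 ^ prime_weight p"
proof (induction p rule: less_induct)
  case (less p)
  show ?case
  proof (cases "p = 2")
    case True
    then show ?thesis by (simp add: prime_weight.simps)
  next
    case False
    with less.prems have p: "p > 2"
      using prime_ge_2_nat[of p] by auto
    define m where "m = (p + 1) div 2"
    have m: "0 < m" "m < p" "p \<le> 2 * m"
      using p by (auto simp: m_def)
    have "m = prod_mset (prime_factorization m)"
      using m by (simp add: prod_mset_prime_factorization_nat)
    also have "\<dots> \<le> 2 ^ (\<Sum>q\<in>#prime_factorization m. prime_weight q)"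
    proof (rule prod_mset_le_power_sum_mset)
      fix q assume "q \<in># prime_factorization m"
      then have "prime q" "q \<le> m"
        using m by (auto simp: in_prime_factors_iff intro: dvd_imp_le)
      with m less.IH show "q \<le> 2 ^ prime_weight q" by simp
    qed
    finally have "2 * m \<le> 2 ^ prime_weight p"
      using p by (simp add: prime_weight.simps[of p] m_def)
    with m show ?thesis by linarith
  qed
qed

text \<open>Only finitely many positive numbers share a given weight, so the maximum behind
  \<open>B\<close> exists.\<close>

lemma le_power_weight:
  assumes "n > 0"
  shows "n \<le> 2 ^ weight n"
proof -
  have "prod_mset (prime_factorization n) \<le> 2 ^ weight n"
    unfolding weight_def
    by (rule prod_mset_le_power_sum_mset)
       (simp add: prime_le_power_prime_weight in_prime_factors_imp_prime)
  with assms show ?thesis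
    by (simp add: prod_mset_prime_factorization_nat)
qed

section \<open>Effect of \<open>psi_bar\<close> on weight and parity\<close>

lemma psi_bar_pos: "psi_bar n > 0"
  unfolding psi_bar_def by (rule prod_pos) (auto simp: in_prime_factors_iff prime_gt_0_nat)

text \<open>Compare prime by prime: for odd \<open>p\<close> one factor \<open>p\<close> becomes
  \<open>p + 1\<close>, of equal weight; for \<open>p = 2\<close> one factor 2 is lost.\<close>

lemma weight_psi_bar:
  assumes "n > 0"
  shows "weight (psi_bar n) + of_bool (even n) = weight n"
proof -
  let ?g = "\<lambda>p. weight (if p = 2 then 2 ^ (multiplicity p n - 1)
                         else p ^ (multiplicity p n - 1) * (p + 1))"
  have g: "?g p + of_bool (p = 2) = weight (p ^ multiplicity p n)" if "p \<in> prime_factors n" for p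
  proof -
    have "multiplicity p n > 0"
      using that by (simp add: prime_factors_multiplicity)
    then obtain a where "multiplicity p n = Suc a"
      using gr0_implies_Suc by blast
    moreover have "prime p" "p > 0"
      using that by (auto simp: in_prime_factors_iff prime_gt_0_nat)
    ultimately show ?thesis
      using weight_odd_prime[of p]
      by (auto simp: weight_mult weight_power simp del: mult_Suc_right add_Suc_right)
  qed
  have "weight (psi_bar n) = (\<Sum>p\<in>prime_factors n. ?g p)"
    unfolding psi_bar_def
    by (rule weight_prod) (auto simp: in_prime_factors_iff prime_gt_0_nat)
  \<comment> \<open>The indicator of 2 survives in the sum exactly when 2 is a prime factor of
    \<open>n\<close>.\<close>
  moreover have "of_bool (even n) = (\<Sum>p\<in>prime_factors n. of_bool (p = 2) :: nat)"
    using assms by (simp add: of_bool_def in_prime_factors_iff sum.delta)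
  ultimately have "weight (psi_bar n) + of_bool (even n)
      = (\<Sum>p\<in>prime_factors n. weight (p ^ multiplicity p n))"
    by (simp only: sum.distrib [symmetric]) (rule sum.cong[OF refl g])
  also have "\<dots> = weight (\<Prod>p\<in>prime_factors n. p ^ multiplicity p n)"
    by (rule weight_prod [symmetric]) (auto simp: in_prime_factors_iff prime_gt_0_nat)
  also have "\<dots> = weight n"
    using assms by (simp add: prod_prime_factors)
  finally show ?thesis .
qed

text \<open>An odd prime factor \<open>p\<close> contributes the even factor \<open>p + 1\<close>;
  otherwise \<open>n\<close> is a power of 2 with exponent at least 2, and one factor 2
  remains.\<close>

lemma even_psi_bar:
  assumes "n > 2"
  shows "even (psi_bar n)"
proof (cases "\<exists>p. prime p \<and> p dvd n \<and> p \<noteq> 2")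
  case True
  then obtain p where p: "prime p" "p dvd n" "p \<noteq> 2" by blast
  then have "odd p"
    using prime_odd_nat[of p] prime_ge_2_nat[of p] by auto
  moreover have "p ^ (multiplicity p n - 1) * (p + 1) dvd psi_bar n"
    unfolding psi_bar_def
    by (rule dvd_trans[OF _ dvd_prodI[of _ p]]) (use p assms in \<open>auto simp: in_prime_factors_iff\<close>)
  ultimately show ?thesis
    by (auto elim!: dvd_trans[rotated])
next
  case False
  then have "prime_factors n \<subseteq> {2}"
    by (auto simp: in_prime_factors_iff)
  moreover have "n = (\<Prod>p\<in>prime_factors n. p ^ multiplicity p n)"
    using assms by (simp add: prod_prime_factors)
  ultimately have n: "n = 2 ^ multiplicity 2 n"
    using assms by (auto simp: subset_singleton_iff)
  have "multiplicity 2 n > 1"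
  proof (rule ccontr)
    assume "\<not> multiplicity 2 n > 1"
    then have "(2::nat) ^ multiplicity 2 n \<le> 2 ^ 1"
      by (intro power_increasing) auto
    with n assms show False by simp
  qed
  then show ?thesis
    by (subst n) (simp add: psi_bar_prime_power)
qed

section \<open>Orbits and the value of \<open>lam\<close> on odd numbers\<close>

lemma lam_eqI:
  assumes "n > 1" "(psi_bar ^^ k) n = 2"
  shows "lam n = k"
proof -
  have "(psi_bar ^^ j) 1 = 1" for j
    by (induction j) (simp_all add: psi_bar_def)
  moreover have "psi_bar 2 = 1"
    using psi_bar_prime_power[of 2 1] by simp
  ultimately have after: "(psi_bar ^^ Suc j) 2 = 1" for j
    by (simp add: funpow_Suc_right del: funpow.simps)
  have not_less: "\<not> i < j" if "(psi_bar ^^ i) n = 2" "(psi_bar ^^ j) n = 2" for i j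
  proof
    assume "i < j"
    then obtain l where "j = Suc l + i"
      using less_imp_Suc_add by (metis add.commute add_Suc_right)
    then show False
      using that after[of l] by (simp only: funpow_add o_apply)
  qed
  have "(THE k. (psi_bar ^^ k) n = 2) = k"
    by (rule the_equality) (use assms not_less in \<open>meson nat_neq_iff\<close>)+
  with assms show ?thesis by (simp add: lam_def)
qed

text \<open>Each step from an even number above 2 stays even and costs one unit of weight. The
  target 2 itself has weight 1, hence the \<open>Suc\<close>.\<close>

lemma psi_bar_iterate_even:
  assumes "even n" "n > 0" "weight n = Suc k"
  shows "(psi_bar ^^ k) n = 2"
  using assms
proof (induction k arbitrary: n)
  case 0
  then have "n \<le> 2"
    using le_power_weight[of n] by simp
  with 0 show ?case by auto
next
  case (Suc k)
  then have "n \<noteq> 2" by auto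
  moreover have "n \<ge> 2" using Suc.prems by (intro dvd_imp_le)
  ultimately have "n > 2" by simp
  have "(psi_bar ^^ k) (psi_bar n) = 2"
  proof (rule Suc.IH)
    show "even (psi_bar n)" using \<open>n > 2\<close> by (rule even_psi_bar)
    show "psi_bar n > 0" by (rule psi_bar_pos)
    show "weight (psi_bar n) = Suc k"
      using weight_psi_bar[of n] Suc.prems by simp
  qed
  then show ?case by (simp add: funpow_Suc_right del: funpow.simps)
qed

lemma weight_odd_ge_2:
  assumes "odd n" "n > 1"
  shows "weight n \<ge> 2"
proof (rule ccontr)
  assume "\<not> weight n \<ge> 2"
  then have "(2::nat) ^ weight n \<le> 2 ^ 1"
    by (intro power_increasing) auto
  moreover have "n \<noteq> 2" using assms by auto
  ultimately show False
    using le_power_weight[of n] assms by simp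
qed

text \<open>The first step leads to an even number at no cost in weight, and the orbit stops at 2
  with weight 1 left over; these two deviations cancel.\<close>

lemma lam_odd:
  assumes "odd n"
  shows "lam n = weight n"
proof (cases "n = 1")
  case True
  then show ?thesis by (simp add: lam_def)
next
  case False
  moreover have "n \<noteq> 0" "n \<noteq> 2" using assms by (auto intro: ccontr)
  ultimately have n: "n > 2" by linarith
  have w: "weight (psi_bar n) = weight n"
    using weight_psi_bar[of n] n assms by simp
  obtain k where k: "weight n = Suc k"
    using weight_odd_ge_2[of n] n assms by (cases "weight n") auto
  have "(psi_bar ^^ k) (psi_bar n) = 2"
    using even_psi_bar[OF n] psi_bar_pos w k by (intro psi_bar_iterate_even) auto
  then have "(psi_bar ^^ Suc k) n = 2"
    by (simp add: funpow_Suc_right del: funpow.simps)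
  with lam_eqI[of n "Suc k"] n k show ?thesis by simp
qed

lemma lam_mult: "odd m \<Longrightarrow> odd n \<Longrightarrow> lam (m * n) = lam m + lam n"
  by (simp add: lam_odd weight_mult odd_pos)

section \<open>Attained values and maximality\<close>

lemma ex_odd_lam_eq: "k \<noteq> 1 \<Longrightarrow> \<exists>n. odd n \<and> lam n = k"
proof (induction k rule: less_induct)
  case (less k)
  have w3: "weight 3 = 2"
    using weight_odd_prime[of 3] weight_power[of 2 2] by simp
  have w5: "weight 5 = 3"
    using weight_odd_prime[of 5] weight_mult[of 2 3] w3 by simp
  \<comment> \<open>Multiplying by 3 raises \<open>lam\<close> by 2. The value 3 needs its own
    witness because \<open>k - 2\<close> is then the excluded 1.\<close>
  consider "k = 0" | "k = 3" | "k \<ge> 2" "k \<noteq> 3"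
    using less.prems by linarith
  then show ?case
  proof cases
    case 1
    then show ?thesis by (intro exI[of _ 1]) (simp add: lam_odd)
  next
    case 2
    then show ?thesis by (intro exI[of _ 5]) (simp add: lam_odd w5)
  next
    case 3
    then have "k - 2 < k" "k - 2 \<noteq> 1" by auto
    then obtain n where "odd n" "lam n = k - 2"
      using less.IH by blast
    with 3 show ?thesis
      by (intro exI[of _ "3 * n"]) (simp add: lam_mult lam_odd[of 3] w3)
  qed
qed

lemma B_greatest:
  assumes "k \<noteq> 1"
  shows "odd (B k)" "lam (B k) = k" and "\<And>n. odd n \<Longrightarrow> lam n = k \<Longrightarrow> n \<le> B k"
proof -
  let ?P = "\<lambda>n. n > 0 \<and> odd n \<and> lam n = k"
  \<comment> \<open>Without an upper bound \<open>GREATEST\<close> would carry no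
    information.\<close>
  have bound: "\<forall>n. ?P n \<longrightarrow> n \<le> 2 ^ k"
    using le_power_weight by (auto simp: lam_odd)
  obtain m where "?P m"
    using ex_odd_lam_eq[OF assms] odd_pos by blast
  then have "?P (B k)"
    unfolding B_def by (rule GreatestI_nat[of ?P m "2 ^ k"]) (use bound in auto)
  then show "odd (B k)" "lam (B k) = k" by auto
  show "n \<le> B k" if "odd n" "lam n = k" for n
    unfolding B_def by (rule Greatest_le_nat[of ?P _ "2 ^ k"]) (use that bound odd_pos in auto)
qed

theorem theorem2p5:
  fixes x d :: nat
  assumes "x \<in> B_set" and "d > 0" and "d dvd x"
  shows "d \<in> B_set"
proof -
  obtain k where k: "x = B k" "k \<noteq> 1"
    using assms(1) by (auto simp: B_set_def)
  obtain e where e: "x = d * e"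
    using assms(3) by (auto elim: dvdE)
  have odd: "odd d" "odd e"
    using B_greatest(1)[OF k(2)] by (simp_all add: k(1)[symmetric] e)
  have lam_k: "lam d + lam e = k"
    using B_greatest(2)[OF k(2)] odd by (simp add: k(1)[symmetric] e lam_mult)
  have "n \<le> d" if "odd n" "lam n = lam d" for n
  proof -
    have "n * e \<le> d * e"
      using B_greatest(3)[OF k(2), of "n * e"] that odd lam_k
      by (simp add: k(1)[symmetric] e lam_mult)
    then show ?thesis using odd_pos[OF odd(2)] by simp
  qed
  then have "B (lam d) = d"
    unfolding B_def using assms(2) odd by (intro Greatest_equality) auto
  \<comment> \<open>Either \<open>d = 1\<close> with value 0, or the weight of the odd
    \<open>d\<close> is at least 2.\<close>
  moreover have "lam d \<noteq> 1"
    using weight_odd_ge_2[of d] odd assms(2) by (cases "d = 1") (auto simp: lam_odd)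
  ultimately show ?thesis
    unfolding B_set_def by force
qed

end
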